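(* Let $\mathcal{P}$ be a finite set of primes which is sufficiently large and such that every $p\in\mathcal{P}$ satisfies $\operatorname{LM}(G(0))=\operatorname{LM}(G(p))$. Then the reduced Gröbner bases $G(p)$, $p\in\mathcal{P}$, lift via the error tolerant lifting algorithm to the reduced Gröbner basis $G(0)$. That is: let $N=\prod_{p\in\mathcal{P}}p$ and let $G(N)\subseteq(\mathbb{Z}/N\mathbb{Z})[X]$ be the coefficientwise Chinese remainder lift of the $G(p)$, $p\in\mathcal{P}$; then the error tolerant lifting algorithm, applied to $N$ and to each coefficient of each polynomial in $G(N)$, returns a rational number (and not false), and the set of polynomials in $\mathbb{Q}[X]$ obtained from $G(N)$ by replacing each coefficient by the returned rational number is $G(0)$.
   Context: Setting. Let $X=\{X_1,\ldots,X_n\}$ be variables and fix a global monomial ordering on the monomials in $X$. Put $W=\mathbb{Q}[X]$ and, for an integer $N\geq2$, $W_N=(\mathbb{Z}/N\mathbb{Z})[X]$. For a set $T$ of polynomials in $W$ or $W_N$, $\operatorname{LM}(T)=\{\operatorname{LM}(f)\mid f\in T\}$ is its set of leading monomials. For $f\in W$ such that $N$ is coprime to all denominators of coefficients of $f$, $f_N\in W_N$ is obtained by reducing each coefficient modulo $N$. For an ideal $J\subseteq W$, its reduction modulo $N$ is $J_N=\langle f_N\mid f\in J\cap\mathbb{Z}[X]\rangle\subseteq W_N$. Fix an ideal $I\subset W$. We are given a construction which associates to $I$ a uniquely determined ideal $U(0)\subseteq W$ and to each reduction $I_p$, $p$ a prime, a uniquely determined ideal $U(p)\subseteq W_p$,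 and we assume that $U(0)_p=U(p)$ for all but finitely many primes $p$. $G(0)$ denotes the reduced Gröbner basis of $U(0)$, and $G(p)$ the reduced Gröbner basis of $U(p)$. Lucky primes. A prime $p$ is called lucky if $U(0)_p=U(p)$ and $\operatorname{LM}(G(0))=\operatorname{LM}(G(p))$; otherwise it is called unlucky. Sufficiently large sets. For a finite set of primes $\mathcal{P}$, let $N'$ be the product of all lucky $p\in\mathcal{P}$ and $M$ the product of all unlucky $p\in\mathcal{P}$ (empty products are $1$). $\mathcal{P}$ is called sufficiently large if $N'>(a^2+b^2)\cdot M$ for all coefficients $\frac ab$ (with $\gcd(a,b)=1$) of polynomials in $G(0)$. Chinese remainder lift. If $\operatorname{LM}(G(p))$ is the same set for all $p\in\mathcal{P}$, elements of the different $G(p)$ with the same leading monomial are identified as corresponding to each other; $G(N)$ consists, for each such leading monomial, of the unique polynomial in $W_N$ whose reduction modulo each $p\in\mathcal{P}$ is the corresponding element of $G(p)$. Error tolerant lifting algorithm. Input: integers $N\geq2$ and $0\leq r\leq N-1$ (here $r$ represents a coefficient in $\mathbb{Z}/N\mathbb{Z}$). Set $(a_0,b_0)=(N,0)$, $(a_1,b_1)=(r,1)$, $i=-1$. Repeat: increase $i$ by $1$; let $q_i$ be the nearest integer to $\frac{\langle(a_i,b_i),(a_{i+1},b_{i+1})\rangle}{\|(a_{i+1},b_{i+1})\|^2}$ (standard inner product and Euclidean norm on $\mathbb{R}^2$); set $(a_{i+2},b_{i+2})=(a_i,b_i)-q_i(a_{i+1},b_{i+1})$; until $a_{i+2}^2+b_{i+2}^2\geq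 a_{i+1}^2+b_{i+1}^2$. Then, if $a_{i+1}^2+b_{i+1}^2<N$, return $\frac{a_{i+1}}{b_{i+1}}$; otherwise return false. *)

theory Defs
  imports
    "HOL-Algebra.Algebraic_Closure_Type"
    "HOL-Number_Theory.Residues"
    "HOL-Number_Theory.Modular_Inverse"
    "HOL-Library.Poly_Mapping"
begin

text \<open>
  Monomials are exponent vectors over the finite type \<open>'n\<close> of variables; multiplication of
  monomials is addition of exponent vectors.  Polynomials are finitely supported maps from
  monomials to coefficients, with the convolution product of \<^theory>\<open>HOL-Library.Poly_Mapping\<close>.
\<close>

type_synonym 'n monom = "'n \<Rightarrow>\<^sub>0 nat"
type_synonym ('n, 'c) mpoly = "'n monom \<Rightarrow>\<^sub>0 'c"

abbreviation mcoeff :: "('n, 'c::zero) mpoly \<Rightarrow> 'n monom \<Rightarrow> 'c"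
  where "mcoeff \<equiv> Poly_Mapping.lookup"


section \<open>The polynomial rings\<close>

abbreviation W :: "('n::finite, rat) mpoly ring"
  where "W \<equiv> ring_of_type_algebra"

definition mod_coeffs :: "nat \<Rightarrow> ('n, int) mpoly \<Rightarrow> ('n, int) mpoly"
  where "mod_coeffs N f = Poly_Mapping.map (\<lambda>c. c mod int N) f"

text \<open>
  The modulus varies within the statement, so \<open>\<int>/N\<int>\<close> is \<^const>\<open>residue_ring\<close>: an element of
  \<open>(\<int>/N\<int>)[X]\<close> is an integer polynomial all of whose coefficients lie in \<open>{0..N-1}\<close>.
\<close>

definition W_mod :: "nat \<Rightarrow> ('n::finite, int) mpoly ring"
  where "W_mod N =
    \<lparr>carrier = {f. \<forall>m. mcoeff f m \<in> carrier (residue_ring (int N))},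
     monoid.mult = \<lambda>f g. mod_coeffs N (f * g),
     one = mod_coeffs N 1,
     zero = 0,
     add = \<lambda>f g. mod_coeffs N (f + g)\<rparr>"

lemma coeff_mod_coeffs [simp]: "mcoeff (mod_coeffs N f) m = mcoeff f m mod int N"
  by (simp add: mod_coeffs_def map.rep_eq when_def)

lemma mod_coeffs_eq_iff:
  "mod_coeffs N f = mod_coeffs N g \<longleftrightarrow> (\<forall>m. mcoeff f m mod int N = mcoeff g m mod int N)"
  by (simp add: poly_mapping_eq_iff fun_eq_iff)

lemma lookup_of_nat_mult:
  fixes f :: "('n, int) mpoly"
  shows "mcoeff (of_nat N * f) m = int N * mcoeff f m"
  by (induction N) (simp_all add: algebra_simps lookup_add)

lemma W_mod_cring:
  assumes "N > 0"
  shows "cring (W_mod N :: ('n::finite, int) mpoly ring)"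
proof -
  have red_add: "mod_coeffs N (mod_coeffs N f + g) = mod_coeffs N (f + g)"
      "mod_coeffs N (f + mod_coeffs N g) = mod_coeffs N (f + g)" for f g :: "('n, int) mpoly"
    by (simp_all add: mod_coeffs_eq_iff lookup_add mod_simps)
  have red_mult: "mod_coeffs N (mod_coeffs N f * g) = mod_coeffs N (f * g)"
      "mod_coeffs N (g * mod_coeffs N f) = mod_coeffs N (g * f)" for f g :: "('n, int) mpoly"
  proof -
    define h where "h = Poly_Mapping.map (\<lambda>c. c div int N) f"
    have "f = mod_coeffs N f + of_nat N * h"
      by (rule poly_mapping_eqI)
         (simp add: lookup_add h_def lookup_of_nat_mult map.rep_eq when_def)
    hence "mod_coeffs N (f * g) =
        mod_coeffs N (mod_coeffs N f * g + of_nat N * (h * g))"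
      by (metis distrib_right mult.assoc)
    also have "\<dots> = mod_coeffs N (mod_coeffs N f * g)"
      by (simp add: mod_coeffs_eq_iff lookup_add lookup_of_nat_mult)
    finally show "mod_coeffs N (mod_coeffs N f * g) = mod_coeffs N (f * g)" ..
    thus "mod_coeffs N (g * mod_coeffs N f) = mod_coeffs N (g * f)"
      by (simp add: mult.commute)
  qed
  have carr: "f \<in> carrier (W_mod N) \<longleftrightarrow> mod_coeffs N f = f" for f :: "('n, int) mpoly"
    using assms by (auto simp: W_mod_def residue_ring_def poly_mapping_eq_iff fun_eq_iff
        mod_pos_pos_trivial)
       (metis pos_mod_sign of_nat_0_less_iff, smt (verit) pos_mod_bound of_nat_0_less_iff)
  have idem: "mod_coeffs N (mod_coeffs N f) = mod_coeffs N f" for f :: "('n, int) mpoly"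
    by (simp add: mod_coeffs_eq_iff)
  have zero: "mod_coeffs N (0 :: ('n, int) mpoly) = 0"
    by (simp add: poly_mapping_eq_iff fun_eq_iff)
  show ?thesis
  proof (intro cringI abelian_groupI comm_monoidI)
    fix f :: "('n, int) mpoly" assume "f \<in> carrier (W_mod N)"
    show "\<exists>g\<in>carrier (W_mod N). g \<oplus>\<^bsub>W_mod N\<^esub> f = \<zero>\<^bsub>W_mod N\<^esub>"
      by (rule bexI[of _ "mod_coeffs N (- f)"])
         (simp_all add: carr idem red_add, simp add: W_mod_def red_add zero)
  qed (simp_all add: carr, simp_all add: W_mod_def red_add red_mult idem zero algebra_simps)
qed

definition residue :: "nat \<Rightarrow> rat \<Rightarrow> int"
  where "residue N c =
    (case quotient_of c of (a, b) \<Rightarrow> (a * modular_inverse (int N) b) mod int N)"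

text \<open>\<open>f\<^sub>N\<close>, meaningful if \<open>N\<close> is coprime to all denominators of coefficients of \<open>f\<close>\<close>

definition reduce_poly :: "nat \<Rightarrow> ('n, rat) mpoly \<Rightarrow> ('n, int) mpoly"
  where "reduce_poly N f = Poly_Mapping.map (residue N) f"

definition integral_polys :: "('n, rat) mpoly set"
  where "integral_polys = {f. \<forall>m. mcoeff f m \<in> \<int>}"

definition reduction :: "nat \<Rightarrow> ('n::finite, rat) mpoly set \<Rightarrow> ('n, int) mpoly set"
  where "reduction N J = Idl\<^bsub>W_mod N\<^esub> (reduce_poly N ` (J \<inter> integral_polys))"


section \<open>Monomial orderings and reduced Groebner bases\<close>

definition global_ordering :: "('n monom \<Rightarrow> 'n monom \<Rightarrow> bool) \<Rightarrow> bool"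
  where "global_ordering mle \<longleftrightarrow>
    linear_order {(s, t). mle s t} \<and>
    (\<forall>s t u. mle s t \<longrightarrow> mle (s + u) (t + u)) \<and>
    (\<forall>t. mle 0 t)"

definition lm :: "('n monom \<Rightarrow> 'n monom \<Rightarrow> bool) \<Rightarrow> ('n, 'c::zero) mpoly \<Rightarrow> 'n monom"
  where "lm mle f = (THE m. m \<in> Poly_Mapping.keys f \<and> (\<forall>m' \<in> Poly_Mapping.keys f. mle m' m))"

text \<open>The zero polynomial has no leading monomial and is left out.\<close>

definition LM :: "('n monom \<Rightarrow> 'n monom \<Rightarrow> bool) \<Rightarrow> ('n, 'c::zero) mpoly set \<Rightarrow> 'n monom set"
  where "LM mle T = lm mle ` (T - {0})"

definition leading_ideal ::
  "('n, 'c::zero_neq_one) mpoly ring \<Rightarrow> ('n monom \<Rightarrow> 'n monom \<Rightarrow> bool)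
    \<Rightarrow> ('n, 'c) mpoly set \<Rightarrow> ('n, 'c) mpoly set"
  where "leading_ideal R mle T = Idl\<^bsub>R\<^esub> ((\<lambda>m. Poly_Mapping.single m 1) ` LM mle T)"

definition is_groebner_basis ::
  "('n, 'c::zero_neq_one) mpoly ring \<Rightarrow> ('n monom \<Rightarrow> 'n monom \<Rightarrow> bool)
    \<Rightarrow> ('n, 'c) mpoly set \<Rightarrow> ('n, 'c) mpoly set \<Rightarrow> bool"
  where "is_groebner_basis R mle J G \<longleftrightarrow>
    finite G \<and> G \<subseteq> J \<and> leading_ideal R mle G = leading_ideal R mle J"

definition monom_dvd :: "'n monom \<Rightarrow> 'n monom \<Rightarrow> bool"
  where "monom_dvd s t \<longleftrightarrow> (\<exists>u. t = s + u)"

definition is_reduced_groebner_basis ::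
  "('n, 'c::zero_neq_one) mpoly ring \<Rightarrow> ('n monom \<Rightarrow> 'n monom \<Rightarrow> bool)
    \<Rightarrow> ('n, 'c) mpoly set \<Rightarrow> ('n, 'c) mpoly set \<Rightarrow> bool"
  where "is_reduced_groebner_basis R mle J G \<longleftrightarrow>
    is_groebner_basis R mle J G \<and>
    (\<forall>g\<in>G. g \<noteq> 0 \<and> mcoeff g (lm mle g) = 1 \<and>
      (\<forall>m \<in> Poly_Mapping.keys g. \<forall>h \<in> G - {g}. \<not> monom_dvd (lm mle h) m))"


section \<open>Lucky primes and sufficiently large sets\<close>

definition lucky ::
  "('n::finite monom \<Rightarrow> 'n monom \<Rightarrow> bool) \<Rightarrow> ('n, rat) mpoly set \<Rightarrow> (nat \<Rightarrow> ('n, int) mpoly set)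
    \<Rightarrow> ('n, rat) mpoly set \<Rightarrow> (nat \<Rightarrow> ('n, int) mpoly set) \<Rightarrow> nat \<Rightarrow> bool"
  where "lucky mle U\<^sub>0 U G\<^sub>0 G p \<longleftrightarrow>
    prime p \<and> reduction p U\<^sub>0 = U p \<and> LM mle G\<^sub>0 = LM mle (G p)"

definition sufficiently_large ::
  "('n::finite monom \<Rightarrow> 'n monom \<Rightarrow> bool) \<Rightarrow> ('n, rat) mpoly set \<Rightarrow> (nat \<Rightarrow> ('n, int) mpoly set)
    \<Rightarrow> ('n, rat) mpoly set \<Rightarrow> (nat \<Rightarrow> ('n, int) mpoly set) \<Rightarrow> nat set \<Rightarrow> bool"
  where "sufficiently_large mle U\<^sub>0 U G\<^sub>0 G P \<longleftrightarrow>
    (\<forall>g\<in>G\<^sub>0. \<forall>m \<in> Poly_Mapping.keys g. \<forall>a b. quotient_of (mcoeff g m) = (a, b) \<longrightarrow>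
      int (\<Prod>{p\<in>P. lucky mle U\<^sub>0 U G\<^sub>0 G p})
        > (a\<^sup>2 + b\<^sup>2) * int (\<Prod>{p\<in>P. \<not> lucky mle U\<^sub>0 U G\<^sub>0 G p}))"


section \<open>Chinese remainder lift\<close>

text \<open>
  By the Chinese remainder theorem there is exactly one \<open>F\<close> for each common leading monomial \<open>m\<close>:
  elements of different \<open>G p\<close> correspond to each other if they have the same leading monomial.
\<close>

definition crt_lift ::
  "('n::finite monom \<Rightarrow> 'n monom \<Rightarrow> bool) \<Rightarrow> nat set \<Rightarrow> (nat \<Rightarrow> ('n, int) mpoly set)
    \<Rightarrow> ('n, int) mpoly set"
  where "crt_lift mle P G =
    {F \<in> carrier (W_mod (\<Prod>P)). \<exists>m \<in> (\<Union>p\<in>P. LM mle (G p)).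
      \<forall>p\<in>P. mod_coeffs p F \<in> G p \<and> lm mle (mod_coeffs p F) = m}"


section \<open>Error tolerant lifting\<close>

definition inner2 :: "int \<times> int \<Rightarrow> int \<times> int \<Rightarrow> int"
  where "inner2 u v = fst u * fst v + snd u * snd v"

text \<open>If two integers are equally near, \<^const>\<open>round\<close> takes the larger one.\<close>

definition lift_step :: "int \<times> int \<Rightarrow> int \<times> int \<Rightarrow> int \<times> int"
  where "lift_step u v =
    (let q = round (of_int (inner2 u v) / of_int (inner2 v v) :: rat)
     in (fst u - q * fst v, snd u - q * snd v))"

text \<open>
  The arguments are \<open>(a\<^sub>i, b\<^sub>i)\<close> and \<open>(a\<^sub>i\<^sub>+\<^sub>1, b\<^sub>i\<^sub>+\<^sub>1)\<close>; the result is the value of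
  \<open>(a\<^sub>i\<^sub>+\<^sub>1, b\<^sub>i\<^sub>+\<^sub>1)\<close> when the loop is left.
\<close>

function lift_loop :: "int \<times> int \<Rightarrow> int \<times> int \<Rightarrow> int \<times> int"
  where "lift_loop u v =
    (let w = lift_step u v in if inner2 w w \<ge> inner2 v v then v else lift_loop v w)"
  by auto
termination
  by (relation "measure (\<lambda>(u, v). nat (inner2 v v))")
     (auto simp: inner2_def not_le intro: le_less_trans[OF sum_squares_ge_zero])

declare lift_loop.simps [simp del]

text \<open>The answer ``false'' is \<^const>\<open>None\<close>.\<close>

definition error_tolerant_lift :: "nat \<Rightarrow> int \<Rightarrow> rat option"
  where "error_tolerant_lift N r =
    (let (a, b) = lift_loop (int N, 0) (r, 1)
     in if a\<^sup>2 + b\<^sup>2 < int N then Some (of_int a / of_int b) else None)"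

definition lift_poly :: "nat \<Rightarrow> ('n, int) mpoly \<Rightarrow> ('n, rat) mpoly"
  where "lift_poly N F = Poly_Mapping.map (\<lambda>r. the (error_tolerant_lift N r)) F"

end

theory Submission
  imports Defs
begin

text \<open>
  At a lucky prime \<open>p\<close> and for \<open>g \<in> G(0)\<close>, \<open>h \<in> G(p)\<close> with the same leading monomial, clear
  denominators in \<open>g\<close> by \<open>D\<close>.  Then \<open>(D g)\<^sub>p - D h\<close> lies in \<open>U(0)\<^sub>p\<close>, and by reducedness none of its
  monomials is divisible by a leading monomial, so it vanishes.  Hence \<open>p\<close> does not divide the
  denominators of \<open>g\<close>, and \<open>g\<close> reduces to \<open>h\<close>.

  If \<open>r\<close> is the coefficient of the Chinese remainder lift corresponding to a coefficient \<open>a/b\<close> of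
  \<open>G(0)\<close>, then \<open>a \<equiv> r b\<close> modulo \<open>N'\<close>, so \<open>(a M, b M)\<close> lies in the lattice spanned by \<open>(N, 0)\<close> and
  \<open>(r, 1)\<close>, with squared norm less than \<open>N' M = N\<close>.  The lifting algorithm is Gauss--Lagrange reduction
  and stops at a shortest nonzero lattice vector.  As the lattice has determinant \<open>N\<close>, any two of its
  vectors of squared norm less than \<open>N\<close> are linearly dependent, so the returned quotient is \<open>a/b\<close>.
\<close>

section \<open>Gauss--Lagrange reduction\<close>

definition lattice2 :: "int \<times> int \<Rightarrow> int \<times> int \<Rightarrow> (int \<times> int) set"
  where "lattice2 u v = {(x * fst u + y * fst v, x * snd u + y * snd v) | x y. True}"

definition det2 :: "int \<times> int \<Rightarrow> int \<times> int \<Rightarrow> int"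
  where "det2 u v = fst u * snd v - snd u * fst v"

lemma inner2_self_nonneg: "inner2 v v \<ge> 0"
  by (simp add: inner2_def)

lemma inner2_self_eq_0_iff: "inner2 v v = 0 \<longleftrightarrow> v = (0, 0)"
  by (cases v) (auto simp: inner2_def add_nonneg_eq_0_iff)

text \<open>Cauchy-Schwarz in the plane together with its defect term; it turns bounds on two norms
  into a bound on the determinant.\<close>

lemma lagrange_identity: "(det2 s t)\<^sup>2 + (inner2 s t)\<^sup>2 = inner2 s s * inner2 t t"
  by (simp add: det2_def inner2_def power2_eq_square algebra_simps)

text \<open>For lattice and determinant only the integrality of the quotient matters, so its value
  is hidden here.\<close>

lemma lift_step_eq: "\<exists>q. lift_step u v = (fst u - q * fst v, snd u - q * snd v)"
  by (auto simp: lift_step_def Let_def)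

lemma det2_lift_step: "det2 v (lift_step u v) = - det2 u v"
  using lift_step_eq[of u v] by (auto simp: det2_def algebra_simps)

text \<open>Passing from (u, v) to (v, u - q v) is a unimodular change of basis for every integer
  q.\<close>

lemma lattice2_lift_step: "lattice2 v (lift_step u v) = lattice2 u v"
proof -
  obtain q where q: "lift_step u v = (fst u - q * fst v, snd u - q * snd v)"
    using lift_step_eq by blast
  have "(x * fst v + y * (fst u - q * fst v), x * snd v + y * (snd u - q * snd v)) =
      (y * fst u + (x - y * q) * fst v, y * snd u + (x - y * q) * snd v)" for x y
    by (simp add: algebra_simps)
  moreover have "(x * fst u + y * fst v, x * snd u + y * snd v) =
      ((y + x * q) * fst v + x * (fst u - q * fst v), (y + x * q) * snd v + x * (snd u - q * snd v))"
    for x y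
    by (simp add: algebra_simps)
  ultimately show ?thesis
    unfolding lattice2_def q fst_conv snd_conv by blast
qed

text \<open>The step removes from \<open>u\<close> its component along \<open>v\<close> up to the
  rounding error, which is at most 1/2 of \<open>v\<close>.\<close>

lemma lift_step_nearly_orthogonal:
  assumes "v \<noteq> (0, 0)"
  shows "\<bar>2 * inner2 v (lift_step u v)\<bar> \<le> inner2 v v"
proof -
  define n where "n = inner2 v v"
  define x where "x = (of_int (inner2 u v) / of_int n :: rat)"
  have n: "n > 0"
    using assms inner2_self_nonneg[of v] inner2_self_eq_0_iff[of v] by (simp add: n_def)
  have "inner2 v (lift_step u v) = inner2 u v - round x * n"
    by (simp add: x_def n_def lift_step_def Let_def inner2_def algebra_simps)
  hence "(of_int (inner2 v (lift_step u v)) :: rat) = of_int (inner2 u v) - of_int (round x) * of_int n"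
    by (simp only: of_int_diff of_int_mult)
  moreover have "of_int (inner2 u v) = x * of_int n"
    using n by (simp add: x_def)
  ultimately have "(of_int (2 * inner2 v (lift_step u v)) :: rat) = 2 * (x - of_int (round x)) * of_int n"
    by (simp add: algebra_simps)
  hence "(of_int \<bar>2 * inner2 v (lift_step u v)\<bar> :: rat) = \<bar>2 * (x - of_int (round x)) * of_int n\<bar>"
    by (simp only: of_int_abs)
  also have "\<bar>of_int n\<bar> = (of_int n :: rat)" using n by simp
  hence "\<bar>2 * (x - of_int (round x)) * of_int n\<bar> = 2 * \<bar>of_int (round x) - x\<bar> * of_int n"
    by (simp only: abs_mult abs_numeral abs_minus_commute[of x])
  also have "\<dots> \<le> 1 * of_int n"
    using of_int_round_abs_le[of x] n by (intro mult_right_mono) auto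
  finally show ?thesis
    unfolding n_def by (simp only: mult_1 of_int_le_iff)
qed

text \<open>For z = x v + y w the hypotheses bound the norm form x^2 |v|^2 + 2 x y <v, w> + y^2
  |w|^2 below by (x^2 - |x y| + y^2) |v|^2, and the factor is a positive integer unless x = y =
  0.\<close>

lemma nearly_orthogonal_shortest:
  assumes orth: "\<bar>2 * inner2 v w\<bar> \<le> inner2 v v" and le: "inner2 v v \<le> inner2 w w"
    and z: "z \<in> lattice2 v w" "z \<noteq> (0, 0)"
  shows "inner2 v v \<le> inner2 z z"
proof -
  obtain x y where xy: "z = (x * fst v + y * fst w, x * snd v + y * snd w)"
    using z by (auto simp: lattice2_def)
  have "x \<noteq> 0 \<or> y \<noteq> 0" using z xy by auto
  have sq: "x\<^sup>2 + y\<^sup>2 - \<bar>x * y\<bar> = (\<bar>x\<bar> - \<bar>y\<bar>)\<^sup>2 + \<bar>x * y\<bar>"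
    by (simp add: power2_diff abs_mult)
  have ge1: "x\<^sup>2 + y\<^sup>2 - \<bar>x * y\<bar> \<ge> 1"
  proof (cases "x * y = 0")
    case True
    have "x\<^sup>2 + y\<^sup>2 > 0"
      using \<open>x \<noteq> 0 \<or> y \<noteq> 0\<close> by (simp add: sum_power2_gt_zero_iff)
    moreover have "\<bar>x * y\<bar> = 0" using True by simp
    ultimately show ?thesis by linarith
  next
    case False
    hence "\<bar>x * y\<bar> \<ge> 1" by linarith
    thus ?thesis
      unfolding sq using zero_le_power2[of "\<bar>x\<bar> - \<bar>y\<bar>"] by linarith
  qed
  have "inner2 v v * 1 \<le> inner2 v v * (x\<^sup>2 + y\<^sup>2 - \<bar>x * y\<bar>)"
    by (intro mult_left_mono ge1 inner2_self_nonneg)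
  also have "\<dots> = x\<^sup>2 * inner2 v v + y\<^sup>2 * inner2 v v - \<bar>x * y\<bar> * inner2 v v"
    by (simp add: algebra_simps)
  also have "\<dots> \<le> x\<^sup>2 * inner2 v v + y\<^sup>2 * inner2 w w - \<bar>x * y\<bar> * \<bar>2 * inner2 v w\<bar>"
    using mult_left_mono[OF le, of "y\<^sup>2"] mult_left_mono[OF orth, of "\<bar>x * y\<bar>"] by simp
  also have "\<dots> \<le> x\<^sup>2 * inner2 v v + y\<^sup>2 * inner2 w w + (x * y) * (2 * inner2 v w)"
    using abs_ge_minus_self[of "(x * y) * (2 * inner2 v w)"] by (simp only: abs_mult)
  also have "\<dots> = inner2 z z"
    by (simp add: xy inner2_def power2_eq_square algebra_simps)
  finally show ?thesis by simp
qed

text \<open>Every pass keeps the lattice and, up to sign, the determinant; the nonzero determinant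
  keeps \<open>v\<close> nonzero. On exit, \<open>v\<close> and the rejected \<open>w\<close>
  satisfy the hypotheses of \<open>nearly_orthogonal_shortest\<close>.\<close>

lemma lift_loop_shortest:
  assumes "det2 u v \<noteq> 0"
  shows "lift_loop u v \<in> lattice2 u v \<and> lift_loop u v \<noteq> (0, 0) \<and>
    (\<forall>z \<in> lattice2 u v. z \<noteq> (0, 0) \<longrightarrow>
      inner2 (lift_loop u v) (lift_loop u v) \<le> inner2 z z)"
  using assms
proof (induction u v rule: lift_loop.induct)
  case (1 u v)
  define w where "w = lift_step u v"
  have v: "v \<noteq> (0, 0)" using 1(2) by (auto simp: det2_def)
  have L: "lattice2 u v = lattice2 v w" by (simp add: w_def lattice2_lift_step)
  show ?case
  proof (cases "inner2 w w \<ge> inner2 v v")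
    case True
    hence "lift_loop u v = v"
      by (subst lift_loop.simps) (simp add: w_def Let_def)
    moreover have "v \<in> lattice2 v w"
      unfolding lattice2_def mem_Collect_eq
      by (rule exI[of _ 1], rule exI[of _ 0]) simp
    ultimately show ?thesis
      using nearly_orthogonal_shortest[OF _ True] lift_step_nearly_orthogonal[OF v, of u] v
      by (auto simp: L w_def)
  next
    case False
    hence "lift_loop u v = lift_loop v w"
      by (subst lift_loop.simps) (simp add: w_def Let_def)
    moreover have "det2 v w \<noteq> 0"
      using 1(2) by (simp add: w_def det2_lift_step)
    ultimately show ?thesis
      using 1(1)[OF w_def] False L by simp
  qed
qed

text \<open>The cofactor is the determinant of the integer coordinates of \<open>s\<close> and
  \<open>t\<close>.\<close>

lemma det2_dvd_lattice2:
  assumes "s \<in> lattice2 u v" "t \<in> lattice2 u v"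
  shows "det2 u v dvd det2 s t"
proof -
  obtain x1 y1 x2 y2 where
    "s = (x1 * fst u + y1 * fst v, x1 * snd u + y1 * snd v)"
    "t = (x2 * fst u + y2 * fst v, x2 * snd u + y2 * snd v)"
    using assms by (auto simp: lattice2_def)
  hence "det2 s t = det2 u v * (x1 * y2 - x2 * y1)"
    by (simp add: det2_def algebra_simps)
  thus ?thesis by simp
qed

text \<open>Here \<open>t\<close> is the known short vector and \<open>s\<close> the one found by
  the loop. They may differ by a scalar, but linear dependence gives them the same quotient of
  coordinates.\<close>

lemma error_tolerant_lift_eq:
  assumes dvd: "int N dvd a * M - r * (b * M)" and "b \<noteq> 0" and "M \<noteq> 0"
    and less: "(a\<^sup>2 + b\<^sup>2) * M\<^sup>2 < int N"
  shows "error_tolerant_lift N r = Some (of_int a / of_int b)"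
proof -
  define u v t where "u = (int N, 0 :: int)" and "v = (r, 1 :: int)" and "t = (a * M, b * M)"
  define s where "s = lift_loop u v"
  have Npos: "int N > 0"
    using less by (rule le_less_trans[rotated]) simp
  have det: "det2 u v = int N" by (simp add: det2_def u_def v_def)
  obtain k where "a * M - r * (b * M) = int N * k" using dvd by blast
  hence "t = (k * fst u + (b * M) * fst v, k * snd u + (b * M) * snd v)"
    by (simp add: u_def v_def t_def algebra_simps)
  hence t: "t \<in> lattice2 u v" by (auto simp: lattice2_def)
  have tt: "inner2 t t < int N"
    using less by (simp add: t_def inner2_def power2_eq_square algebra_simps)
  have "t \<noteq> (0, 0)" using assms by (simp add: t_def)
  hence s: "s \<in> lattice2 u v" "s \<noteq> (0, 0)" "inner2 s s \<le> inner2 t t"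
    using lift_loop_shortest[of u v] t det Npos by (auto simp: s_def)
  have ss: "inner2 s s < int N" using s tt by linarith
  have "(det2 s t)\<^sup>2 \<le> inner2 s s * inner2 t t"
    using lagrange_identity[of s t] by (smt (verit) zero_le_power2)
  also have "\<dots> < int N * int N"
    using ss tt inner2_self_nonneg by (intro mult_strict_mono') auto
  finally have "\<bar>det2 s t\<bar> < int N"
    using Npos by (metis abs_of_pos power2_eq_square power2_less_imp_less power2_abs less_le_not_le)
  moreover have "int N dvd det2 s t"
    using det2_dvd_lattice2[OF s(1) t] det by simp
  ultimately have "det2 s t = 0"
    using dvd_imp_le_int[of "det2 s t" "int N"] by fastforce
  hence *: "fst s * b = snd s * a"
    using \<open>M \<noteq> 0\<close> by (simp add: det2_def t_def)
  \<comment> \<open>Otherwise \<open>fst s * b = 0\<close> would make \<open>s\<close> zero; so the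
    returned fraction has a nonzero denominator.\<close>
  have "snd s \<noteq> 0"
    using * s(2) \<open>b \<noteq> 0\<close> by (cases s) auto
  moreover have "(of_int (fst s) * of_int b :: rat) = of_int (snd s) * of_int a"
    using * by (metis of_int_mult)
  ultimately have "(of_int (fst s) / of_int (snd s) :: rat) = of_int a / of_int b"
    using \<open>b \<noteq> 0\<close> by (simp add: field_simps)
  thus ?thesis
    using ss unfolding error_tolerant_lift_def u_def[symmetric] v_def[symmetric] s_def[symmetric]
    by (cases s) (simp add: inner2_def power2_eq_square)
qed


section \<open>Leading monomials and monomial ideals\<close>

lemma finite_linear_order_max:
  assumes "linear_order {(s, t). mle s t}" "finite A" "A \<noteq> {}"
  shows "\<exists>m\<in>A. \<forall>m'\<in>A. mle m' m"
  using assms(2,3)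
proof (induction rule: finite_ne_induct)
  case (singleton x)
  thus ?case using assms(1) by (auto simp: order_on_defs refl_on_def)
next
  case (insert x F)
  then obtain m where m: "m \<in> F" "\<forall>m'\<in>F. mle m' m" by blast
  have tr: "mle a c" if "mle a b" "mle b c" for a b c
    using assms(1) that by (auto simp: order_on_defs trans_def)
  have refl: "mle a a" for a
    using assms(1) by (auto simp: order_on_defs refl_on_def)
  have "mle x m \<or> mle m x"
    using assms(1) refl by (cases "x = m") (auto simp: order_on_defs total_on_def)
  thus ?case
    using m tr refl by blast
qed

lemma global_ordering_antisym:
  "global_ordering mle \<Longrightarrow> mle s t \<Longrightarrow> mle t s \<Longrightarrow> s = t"
  by (auto simp: global_ordering_def order_on_defs antisym_def)

text \<open>The finite support has a largest monomial, unique by antisymmetry, so the definite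
  description in \<open>lm\<close> denotes it.\<close>

lemma
  assumes "global_ordering mle" "f \<noteq> 0"
  shows lm_in_keys: "lm mle f \<in> Poly_Mapping.keys f"
    and lm_max: "m \<in> Poly_Mapping.keys f \<Longrightarrow> mle m (lm mle f)"
proof -
  have lin: "linear_order {(s, t). mle s t}"
    using assms by (simp add: global_ordering_def)
  obtain k where k: "k \<in> Poly_Mapping.keys f" "\<forall>m'\<in>Poly_Mapping.keys f. mle m' k"
    using finite_linear_order_max[OF lin, of "Poly_Mapping.keys f"] assms by auto
  have "lm mle f \<in> Poly_Mapping.keys f \<and> (\<forall>m'\<in>Poly_Mapping.keys f. mle m' (lm mle f))"
    unfolding lm_def
    by (rule theI[of _ k]) (use k global_ordering_antisym[OF assms(1)] in blast)+
  thus "lm mle f \<in> Poly_Mapping.keys f" "m \<in> Poly_Mapping.keys f \<Longrightarrow> mle m (lm mle f)"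
    by auto
qed

text \<open>The cofactor lies above \<open>0\<close>, and translation by \<open>s\<close> preserves
  the order.\<close>

lemma monom_dvd_imp_le:
  assumes "global_ordering mle" "monom_dvd s t"
  shows "mle s t"
proof -
  obtain u where "t = s + u" using assms by (auto simp: monom_dvd_def)
  moreover have "mle (0 + s) (u + s)"
    using assms unfolding global_ordering_def by blast
  ultimately show ?thesis by (simp add: add.commute)
qed

lemma keys_mod_coeffs: "Poly_Mapping.keys (mod_coeffs N f) \<subseteq> Poly_Mapping.keys f"
  by (auto simp: in_keys_iff)

lemma carrier_W_mod:
  assumes "N > 0"
  shows "f \<in> carrier (W_mod N) \<longleftrightarrow> (\<forall>m. 0 \<le> mcoeff f m \<and> mcoeff f m < int N)"
  using assms by (auto simp: W_mod_def residue_ring_def)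

lemma mod_coeffs_carrier: "N > 0 \<Longrightarrow> mod_coeffs N f \<in> carrier (W_mod N)"
  by (simp add: carrier_W_mod)

text \<open>This ideal contains the monomials in \<open>S\<close>, hence the ideal they generate, so
  every monomial occurring in the latter is a multiple of some element of \<open>S\<close>. Closure
  holds because each monomial of \<open>f * g\<close> is a multiple of one of \<open>g\<close>, and
  reducing coefficients adds no monomials.\<close>

lemma monomial_ideal_W_mod:
  fixes S :: "'n::finite monom set"
  assumes "N > 0"
  shows "ideal {f \<in> carrier (W_mod N). \<forall>m \<in> Poly_Mapping.keys f. \<exists>s\<in>S. monom_dvd s m} (W_mod N)"
    (is "ideal ?I ?R")
proof -
  interpret cring ?R by (rule W_mod_cring[OF assms])
  have mult: "f \<otimes>\<^bsub>?R\<^esub> g \<in> ?I" if f: "f \<in> carrier ?R" and g: "g \<in> ?I" for f g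
  proof -
    have "\<exists>s\<in>S. monom_dvd s m" if m: "m \<in> Poly_Mapping.keys (f \<otimes>\<^bsub>?R\<^esub> g)" for m
    proof -
      have "m \<in> Poly_Mapping.keys (f * g)"
        using m keys_mod_coeffs by (auto simp: W_mod_def)
      then obtain a b where "m = a + b" "b \<in> Poly_Mapping.keys g"
        using keys_mult[of f g] by blast
      moreover from this obtain s where "s \<in> S" "monom_dvd s b" using g by blast
      ultimately show ?thesis
        by (auto simp: monom_dvd_def) (metis add.left_commute)
    qed
    thus ?thesis using f g by auto
  qed
  have add: "f \<oplus>\<^bsub>?R\<^esub> g \<in> ?I" if "f \<in> ?I" "g \<in> ?I" for f g
  proof -
    have "Poly_Mapping.keys (f \<oplus>\<^bsub>?R\<^esub> g) \<subseteq> Poly_Mapping.keys f \<union> Poly_Mapping.keys g"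
      using keys_mod_coeffs[of N "f + g"] keys_add[of f g] by (auto simp: W_mod_def)
    thus ?thesis using that by fastforce
  qed
  have neg: "\<ominus>\<^bsub>?R\<^esub> f \<in> ?I" if "f \<in> ?I" for f
    using mult[OF _ that, of "\<ominus>\<^bsub>?R\<^esub> \<one>\<^bsub>?R\<^esub>"] that by (simp add: l_minus)
  have zero: "\<zero>\<^bsub>?R\<^esub> \<in> ?I"
    using zero_closed by (auto simp: W_mod_def)
  define J where "J = ?I"
  have carr: "J \<subseteq> carrier ?R" by (auto simp: J_def)
  note closed = mult[folded J_def] add[folded J_def] neg[folded J_def] zero[folded J_def]
  have "ideal J ?R"
  proof (rule idealI)
    show "ring ?R" by (rule ring_axioms)
    show "subgroup J (add_monoid ?R)"
      by (rule subgroup.intro) (use carr closed in \<open>simp_all add: a_inv_def\<close>)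
    show "x \<otimes>\<^bsub>?R\<^esub> a \<in> J" if "a \<in> J" "x \<in> carrier ?R" for a x
      using closed(1)[OF that(2,1)] .
    show "a \<otimes>\<^bsub>?R\<^esub> x \<in> J" if a: "a \<in> J" and x: "x \<in> carrier ?R" for a x
      using closed(1)[OF x a] m_comm[OF subsetD[OF carr a] x] by simp
  qed
  thus ?thesis by (simp only: J_def)
qed

text \<open>If \<open>f\<close> were nonzero, its leading monomial would lie in the leading ideal of
  \<open>G\<close> and so be divisible by a leading monomial of \<open>G\<close>.\<close>

lemma groebner_basis_irreducible_eq_0:
  fixes J :: "('n::finite, int) mpoly set"
  assumes ord: "global_ordering mle" and N: "N > 1"
    and GB: "is_groebner_basis (W_mod N) mle J G"
    and f: "f \<in> J"
    and irr: "\<And>m s. m \<in> Poly_Mapping.keys f \<Longrightarrow> s \<in> LM mle G \<Longrightarrow> \<not> monom_dvd s m"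
  shows "f = 0"
proof (rule ccontr)
  assume nz: "f \<noteq> 0"
  let ?I = "{f \<in> carrier (W_mod N). \<forall>m \<in> Poly_Mapping.keys f. \<exists>s\<in>LM mle G. monom_dvd s m}"
  have "Poly_Mapping.single (lm mle f) 1 \<in> leading_ideal (W_mod N) mle J"
    using f nz by (auto simp: leading_ideal_def genideal_def LM_def)
  also have "\<dots> = leading_ideal (W_mod N) mle G"
    using GB by (simp add: is_groebner_basis_def)
  also have "\<dots> \<subseteq> ?I"
  proof -
    \<comment> \<open>Since \<open>N > 1\<close>, the coefficient 1 is a residue in range.\<close>
    have "(\<lambda>m. Poly_Mapping.single m 1) ` LM mle G \<subseteq> ?I"
      using N by (auto simp: carrier_W_mod lookup_single when_def monom_dvd_def
          intro!: bexI exI[of _ 0])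
    thus ?thesis
      unfolding leading_ideal_def genideal_def
      using monomial_ideal_W_mod[of N "LM mle G"] N by blast
  qed
  finally have "\<exists>s\<in>LM mle G. monom_dvd s (lm mle f)" by simp
  thus False
    using irr lm_in_keys[OF ord nz] by blast
qed

text \<open>Reducedness excludes divisors from the other elements of \<open>G\<close>; the leading
  monomial of \<open>g\<close> itself is too large to divide a tail monomial.\<close>

lemma reduced_groebner_basis_tail_irreducible:
  assumes ord: "global_ordering mle" and red: "is_reduced_groebner_basis R mle J G"
    and g: "g \<in> G" and m: "m \<in> Poly_Mapping.keys g" "m \<noteq> lm mle g"
    and s: "s \<in> LM mle G"
  shows "\<not> monom_dvd s m"
proof
  assume dvd: "monom_dvd s m"
  obtain h where h: "h \<in> G" "s = lm mle h" using s by (auto simp: LM_def)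
  have "h = g"
    using red g h m dvd by (auto simp: is_reduced_groebner_basis_def)
  hence "mle (lm mle g) m"
    using monom_dvd_imp_le[OF ord dvd] h by simp
  moreover have "mle m (lm mle g)"
    using lm_max[OF ord _ m(1)] m(1) by force
  ultimately show False
    using global_ordering_antisym[OF ord] m(2) by blast
qed


section \<open>Reduction modulo a lucky prime\<close>

lemma lookup_of_nat_times:
  fixes f :: "'n monom \<Rightarrow>\<^sub>0 'c::comm_ring_1"
  shows "mcoeff (of_nat k * f) m = of_nat k * mcoeff f m"
  by (induction k) (simp_all add: algebra_simps lookup_add)

lemma residue_of_int:
  assumes "p > 1"
  shows "residue p (of_int z) = z mod int p"
proof -
  have "[1 * modular_inverse (int p) 1 = 1] (mod int p)"
    by (rule cong_modular_inverse1) simp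
  hence "[z * modular_inverse (int p) 1 = z * 1] (mod int p)"
    by (intro cong_mult cong_refl) simp
  thus ?thesis by (simp add: residue_def cong_def)
qed

lemma lookup_reduce_poly:
  assumes "p > 1"
  shows "mcoeff (reduce_poly p f) m = residue p (mcoeff f m)"
  \<comment> \<open>\<open>Poly_Mapping.map\<close> leaves zero coefficients at 0, which agrees with
    \<open>residue\<close> since the residue of 0 is 0.\<close>
  using residue_of_int[OF assms, of 0]
  by (simp add: reduce_poly_def map.rep_eq when_def)

lemma ideal_reduction:
  assumes "p > 1"
  shows "ideal (reduction p J) (W_mod p)"
proof -
  interpret cring "W_mod p" by (rule W_mod_cring) (use assms in simp)
  have "reduce_poly p ` (J \<inter> integral_polys) \<subseteq> carrier (W_mod p)"
    using assms by (auto simp: carrier_W_mod lookup_reduce_poly residue_def split: prod.splits)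
  thus ?thesis unfolding reduction_def by (rule genideal_ideal)
qed

text \<open>Multiplying by \<open>D\<close> makes \<open>g\<close> integral, so its reduction lies
  in \<open>reduction p J\<close> even when \<open>p\<close> divides \<open>D\<close>. That case is
  what later excludes \<open>p\<close> from the denominators of \<open>g\<close>.\<close>

lemma reduced_groebner_basis_reduction_cong:
  fixes J :: "('n::finite, rat) mpoly set"
  assumes ord: "global_ordering mle" and p: "prime p" and J: "ideal J W"
    and G: "is_reduced_groebner_basis W mle J G"
    and H: "is_reduced_groebner_basis (W_mod p) mle (reduction p J) H"
    and LM: "LM mle G = LM mle H"
    and g: "g \<in> G" and h: "h \<in> H" and lm: "lm mle h = lm mle g"
    and int: "\<And>m. of_nat D * mcoeff g m = of_int (c m)"
  shows "[c m = int D * mcoeff h m] (mod int p)"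
proof -
  have p1: "p > 1" using p by (rule prime_gt_1_nat)
  let ?R = "W_mod p :: ('n, int) mpoly ring"
  let ?J = "reduction p J"
  interpret W: ideal J W by (rule J)
  interpret Wp: ideal ?J ?R by (rule ideal_reduction[OF p1])
  define f where "f = of_nat D * g"
  have f_coeff: "mcoeff f m = of_int (c m)" for m
    by (simp add: f_def lookup_of_nat_times int)
  have "g \<in> J"
    using G g by (auto simp: is_reduced_groebner_basis_def is_groebner_basis_def)
  hence "f \<in> J"
    using W.I_l_closed[of g "of_nat D"] by (simp add: f_def ring_of_type_algebra_def)
  hence "reduce_poly p f \<in> ?J"
    unfolding reduction_def genideal_def integral_polys_def by (auto simp: f_coeff)
  moreover have "h \<in> ?J"
    using H h by (auto simp: is_reduced_groebner_basis_def is_groebner_basis_def)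
  \<comment> \<open>The representative of -D in {0..p-1}, so that subtracting D h becomes adding a
    multiple of \<open>h\<close> by a constant in the carrier.\<close>
  define d where "d = (D * (p - 1)) mod p"
  have "of_nat d \<in> carrier ?R"
    using p1 lookup_of_nat_times[of d "1 :: ('n, int) mpoly"]
    by (auto simp: carrier_W_mod lookup_one when_def d_def)
  hence "of_nat d \<otimes>\<^bsub>?R\<^esub> h \<in> ?J"
    using Wp.I_l_closed \<open>h \<in> ?J\<close> by blast
  ultimately have kJ: "reduce_poly p f \<oplus>\<^bsub>?R\<^esub> (of_nat d \<otimes>\<^bsub>?R\<^esub> h) \<in> ?J" (is "?k \<in> _")
    by (rule additive_subgroup.a_closed[OF Wp.is_additive_subgroup])
  have d: "[int d = - int D] (mod int p)"
  proof -
    have "[int d = int (D * (p - 1))] (mod int p)"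
      by (simp add: d_def cong_def zmod_int)
    also have "int (D * (p - 1)) = - int D + int D * int p"
      using p1 by (simp add: of_nat_diff algebra_simps)
    also have "[\<dots> = - int D] (mod int p)" by (simp add: cong_iff_dvd_diff)
    finally show ?thesis .
  qed
  have k_coeff: "mcoeff ?k m = (c m - int D * mcoeff h m) mod int p" for m
  proof -
    have "?k = mod_coeffs p (reduce_poly p f + mod_coeffs p (of_nat d * h))"
      by (simp add: W_mod_def)
    hence "mcoeff ?k m = (c m mod int p + int d * mcoeff h m mod int p) mod int p"
      by (simp only: coeff_mod_coeffs lookup_add lookup_reduce_poly[OF p1] f_coeff
          residue_of_int[OF p1] lookup_of_nat_mult)
    also have "\<dots> = (c m + int d * mcoeff h m) mod int p"
      by (rule mod_add_eq)
    also have "\<dots> = (c m + (- int D) * mcoeff h m) mod int p"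
      unfolding cong_def[symmetric] by (intro cong_add cong_mult cong_refl d)
    finally show ?thesis by simp
  qed
  \<comment> \<open>Both polynomials are monic with the same leading monomial, so it cancels from
    the difference; only tail monomials of \<open>g\<close> and \<open>h\<close> remain.\<close>
  have "mcoeff g (lm mle g) = 1" "mcoeff h (lm mle g) = 1"
    using G H g h lm by (auto simp: is_reduced_groebner_basis_def)
  moreover from this have "(of_int (c (lm mle g)) :: rat) = of_int (int D)"
    using int[of "lm mle g"] by simp
  hence "c (lm mle g) = int D" by (simp only: of_int_eq_iff)
  ultimately have top: "lm mle g \<notin> Poly_Mapping.keys ?k"
    by (simp add: in_keys_iff k_coeff)
  have "?k = 0"
  proof (rule groebner_basis_irreducible_eq_0[OF ord p1 _ kJ])
    show "is_groebner_basis ?R mle ?J H"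
      using H by (simp add: is_reduced_groebner_basis_def)
    fix m s assume m: "m \<in> Poly_Mapping.keys ?k" and s: "s \<in> LM mle H"
    have ne: "m \<noteq> lm mle g" using m top by auto
    have "m \<in> Poly_Mapping.keys g \<or> m \<in> Poly_Mapping.keys h"
      using m int[of m] by (auto simp: in_keys_iff k_coeff)
    thus "\<not> monom_dvd s m"
      using reduced_groebner_basis_tail_irreducible[OF ord G g]
        reduced_groebner_basis_tail_irreducible[OF ord H h] ne s LM lm by metis
  qed
  hence "(c m - int D * mcoeff h m) mod int p = 0"
    using k_coeff[of m] by simp
  thus ?thesis by (simp add: cong_iff_dvd_diff dvd_eq_mod_eq_0)
qed

text \<open>The product of the denominators over the support works; mere existence allows a least
  one to be chosen later.\<close>

lemma common_denominator:
  fixes g :: "('n, rat) mpoly"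
  shows "\<exists>D>0. \<forall>m. of_nat D * mcoeff g m \<in> \<int>"
proof -
  define q where "q m = nat (snd (quotient_of (mcoeff g m)))" for m
  have pos: "q m > 0" for m
    by (simp add: q_def quotient_of_denom_pos')
  have int: "of_nat (q m) * mcoeff g m \<in> \<int>" for m
  proof -
    obtain a b where ab: "quotient_of (mcoeff g m) = (a, b)" by fastforce
    hence "b > 0" "mcoeff g m = of_int a / of_int b"
      by (simp_all add: quotient_of_denom_pos quotient_of_div)
    thus ?thesis using ab by (simp add: q_def)
  qed
  have "of_nat (\<Prod>m\<in>Poly_Mapping.keys g. q m) * mcoeff g k \<in> \<int>" for k
  proof (cases "k \<in> Poly_Mapping.keys g")
    case True
    hence "(\<Prod>m\<in>Poly_Mapping.keys g. q m) = (\<Prod>m\<in>Poly_Mapping.keys g - {k}. q m) * q k"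
      by (simp add: prod.remove mult.commute)
    thus ?thesis using int[of k] by (simp add: mult.assoc del: of_nat_prod)
  qed (simp add: in_keys_iff)
  moreover have "(\<Prod>m\<in>Poly_Mapping.keys g. q m) > 0"
    using pos by (simp add: prod_pos)
  ultimately show ?thesis by blast
qed

text \<open>
  If \<open>p\<close> divided the least common denominator \<open>D\<close> of \<open>g\<close>, the congruence for \<open>D\<close> would make every
  coefficient of \<open>D g\<close> divisible by \<open>p\<close>, so that \<open>D / p\<close> would be a smaller common denominator.
\<close>

lemma reduced_groebner_basis_reduction_coeff:
  fixes J :: "('n::finite, rat) mpoly set"
  assumes ord: "global_ordering mle" and p: "prime p" and J: "ideal J W"
    and G: "is_reduced_groebner_basis W mle J G"
    and H: "is_reduced_groebner_basis (W_mod p) mle (reduction p J) H"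
    and LM: "LM mle G = LM mle H"
    and g: "g \<in> G" and h: "h \<in> H" and lm: "lm mle h = lm mle g"
    and ab: "quotient_of (mcoeff g m) = (a, b)"
  shows "[a = mcoeff h m * b] (mod int p)"
proof -
  let ?P = "\<lambda>D. D > 0 \<and> (\<forall>m. of_nat D * mcoeff g m \<in> \<int>)"
  define D where "D = (LEAST D. ?P D)"
  have D: "?P D" unfolding D_def using common_denominator[of g] by (rule LeastI_ex)
  then obtain c where c: "of_nat D * mcoeff g m = of_int (c m)" for m
    unfolding Ints_def by (auto simp: image_iff) metis
  have cong: "[c m = int D * mcoeff h m] (mod int p)" for m
    using assms(1-9) c by (rule reduced_groebner_basis_reduction_cong)
  have "\<not> p dvd D"
  proof
    assume "p dvd D"
    then obtain E where E: "D = p * E" by blast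
    have "int p dvd c m" for m
      using cong[of m] \<open>p dvd D\<close> by (meson cong_dvd_iff dvd_mult2 int_dvd_int_iff)
    then obtain e where e: "c m = int p * e m" for m
      unfolding dvd_def by metis
    have "of_nat E * mcoeff g m = of_int (e m)" for m
      using c[of m] p prime_gt_0_nat[OF p] by (simp add: E e)
    hence "?P E" using D E by auto
    hence "D \<le> E" unfolding D_def by (rule Least_le)
    thus False using D E prime_gt_1_nat[OF p] by auto
  qed
  hence cop: "coprime (int D) (int p)"
    using prime_imp_coprime[OF p \<open>\<not> p dvd D\<close>]
    by (simp add: coprime_commute[of D])
  have "b > 0" "mcoeff g m = of_int a / of_int b"
    using ab by (simp_all add: quotient_of_denom_pos quotient_of_div)
  \<comment> \<open>Multiplied by \<open>D\<close>, this becomes an identity of integers; after the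
    congruence for \<open>c m\<close>, the unit \<open>D\<close> modulo \<open>p\<close> is
    cancelled.\<close>
  hence "of_int a = mcoeff g m * of_int b" by simp
  hence "(of_int (int D * a) :: rat) = of_int (c m * b)"
    using c[of m] by (simp add: mult.assoc[symmetric])
  hence "int D * a = c m * b" by (simp only: of_int_eq_iff)
  moreover have "[c m * b = int D * mcoeff h m * b] (mod int p)"
    using cong by (rule cong_scalar_right)
  ultimately have "[int D * a = int D * (mcoeff h m * b)] (mod int p)"
    by (simp add: mult.assoc)
  thus ?thesis using cop by (simp add: cong_mult_lcancel)
qed


section \<open>The Chinese remainder lift\<close>

lemma prod_primes_pos:
  fixes P :: "nat set"
  assumes "\<And>p. p \<in> P \<Longrightarrow> prime p"
  shows "\<Prod>P > 0"
  by (rule prod_pos) (use assms in \<open>auto intro: prime_gt_0_nat\<close>)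

text \<open>The Chinese remainder theorem is applied to each coefficient, on the finite union of the
  supports.\<close>

lemma crt_poly:
  fixes H :: "nat \<Rightarrow> ('n::finite, int) mpoly"
  assumes fin: "finite P" and prime: "\<And>p. p \<in> P \<Longrightarrow> prime p"
    and H: "\<And>p. p \<in> P \<Longrightarrow> H p \<in> carrier (W_mod p)"
  shows "\<exists>F \<in> carrier (W_mod (\<Prod>P)). \<forall>p\<in>P. mod_coeffs p F = H p"
proof -
  have H': "0 \<le> mcoeff (H p) m" "mcoeff (H p) m < int p" if "p \<in> P" for p m
    using H[OF that] prime_gt_0_nat[OF prime[OF that]] by (simp_all add: carrier_W_mod)
  have pos: "\<Prod>P > 0" using prime by (rule prod_primes_pos)
  have "\<forall>p\<in>P. \<forall>q\<in>P. p \<noteq> q \<longrightarrow> coprime p q"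
    using prime by (auto intro: primes_coprime)
  hence "\<exists>x. \<forall>p\<in>P. [x = nat (mcoeff (H p) m)] (mod p)" for m
    by (rule chinese_remainder_nat[OF fin, of id, simplified])
  then obtain x where x: "[x m = nat (mcoeff (H p) m)] (mod p)" if "p \<in> P" for m p
    by metis
  define K where "K = (\<Union>p\<in>P. Poly_Mapping.keys (H p))"
  \<comment> \<open>Reducing modulo the product puts the coefficient in range and keeps its residues
    modulo each \<open>p\<close>; the value 0 outside \<open>K\<close> ensures finite
    support.\<close>
  define c where "c m = (if m \<in> K then int (x m) mod int (\<Prod>P) else 0)" for m
  define F where "F = Abs_poly_mapping c"
  have "finite K" using fin by (simp add: K_def)
  hence "finite {m. c m \<noteq> 0}"
    by (rule finite_subset[rotated]) (auto simp: c_def)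
  hence F: "mcoeff F m = c m" for m by (simp add: F_def)
  have "F \<in> carrier (W_mod (\<Prod>P))"
    using pos by (simp add: carrier_W_mod F c_def del: of_nat_prod)
  moreover have "mod_coeffs p F = H p" if p: "p \<in> P" for p
  proof (rule poly_mapping_eqI)
    fix m
    show "mcoeff (mod_coeffs p F) m = mcoeff (H p) m"
    proof (cases "m \<in> K")
      case True
      have "int p dvd int (\<Prod>P)" using p fin by (intro of_nat_dvd_iff[THEN iffD2] dvd_prodI) auto
      hence "c m mod int p = int (x m) mod int p"
        using True by (simp add: c_def mod_mod_cancel del: of_nat_prod)
      also have "[int (x m) = int (nat (mcoeff (H p) m))] (mod int p)"
        using x[OF p] by (simp only: cong_int_iff)
      hence "int (x m) mod int p = mcoeff (H p) m mod int p"
        using H'[OF p, of m] by (simp add: cong_def)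
      also have "\<dots> = mcoeff (H p) m"
        using H'[OF p, of m] by simp
      finally show ?thesis by (simp add: F)
    next
      case False
      hence "m \<notin> Poly_Mapping.keys (H p)" using p by (auto simp: K_def)
      thus ?thesis using False by (simp add: F c_def in_keys_iff)
    qed
  qed
  ultimately show ?thesis by blast
qed

lemma lift_poly_eqI:
  assumes "N > 1" and lift: "\<And>m. error_tolerant_lift N (mcoeff F m) = Some (mcoeff g m)"
  shows "lift_poly N F = g"
proof (rule poly_mapping_eqI)
  fix m
  \<comment> \<open>\<open>lift_poly\<close> passes over zero coefficients, so it must agree with
    the algorithm at 0. The short vector is (0, 1), of squared norm 1 < N.\<close>
  have "error_tolerant_lift N 0 = Some 0"
    using error_tolerant_lift_eq[of N 0 1 0 1] assms by simp
  thus "mcoeff (lift_poly N F) m = mcoeff g m"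
    using lift[of m] by (cases "mcoeff F m = 0") (auto simp: lift_poly_def map.rep_eq)
qed

text \<open>The congruences give a - r b divisible only by the product over \<open>L\<close>.
  Multiplying by the product \<open>M\<close> of the other primes extends this to the full modulus,
  and the size bound absorbs the resulting factor \<open>M\<close> squared.\<close>

lemma error_tolerant_lift_lucky:
  assumes fin: "finite P" and prime: "\<And>p. p \<in> P \<Longrightarrow> prime p" and L: "L \<subseteq> P"
    and cong: "\<And>p. p \<in> L \<Longrightarrow> [a = r * b] (mod int p)"
    and b: "b \<noteq> 0" and less: "(a\<^sup>2 + b\<^sup>2) * int (\<Prod>(P - L)) < int (\<Prod>L)"
  shows "error_tolerant_lift (\<Prod>P) r = Some (of_int a / of_int b)"
proof (rule error_tolerant_lift_eq)
  define M where "M = int (\<Prod>(P - L))"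
  have M: "M > 0"
    unfolding M_def of_nat_0_less_iff
    by (rule prod_primes_pos) (use prime in blast)
  have N: "int (\<Prod>P) = int (\<Prod>L) * M"
    unfolding M_def of_nat_mult[symmetric] using prod.subset_diff[OF L fin, of "\<lambda>p. p"]
    by (simp add: mult.commute)
  have "\<forall>p\<in>L. \<forall>q\<in>L. p \<noteq> q \<longrightarrow> coprime (int p) (int q)"
    using prime L by (auto intro!: primes_coprime)
  hence "[a = r * b] (mod (\<Prod>p\<in>L. int p))"
    using cong by (intro cong_cong_prod_coprime) auto
  hence "int (\<Prod>L) dvd a - r * b"
    by (simp add: cong_iff_dvd_diff)
  hence "int (\<Prod>L) * M dvd (a - r * b) * M"
    by (rule mult_dvd_mono) simp
  thus "int (\<Prod>P) dvd a * int (\<Prod>(P - L)) - r * (b * int (\<Prod>(P - L)))"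
    unfolding N M_def[symmetric] by (simp add: algebra_simps)
  have "(a\<^sup>2 + b\<^sup>2) * M * M < int (\<Prod>L) * M"
    using less M unfolding M_def[symmetric] by (rule mult_strict_right_mono)
  thus "(a\<^sup>2 + b\<^sup>2) * (int (\<Prod>(P - L)))\<^sup>2 < int (\<Prod>P)"
    unfolding N M_def[symmetric] by (simp add: power2_eq_square mult.assoc)
  show "int (\<Prod>(P - L)) \<noteq> 0" using M M_def by simp
qed (rule b)

text \<open>
  A vanishing coefficient of \<open>g\<close> is \<open>0/1\<close>, for which the bound follows from that for the leading
  coefficient \<open>1/1\<close>.
\<close>

lemma sufficiently_large_bound:
  assumes ord: "global_ordering mle" and large: "sufficiently_large mle U\<^sub>0 U G\<^sub>0 G P"
    and G: "is_reduced_groebner_basis R mle J G\<^sub>0" and g: "g \<in> G\<^sub>0"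
    and ab: "quotient_of (mcoeff g m) = (a, b)"
  shows "(a\<^sup>2 + b\<^sup>2) * int (\<Prod>{p\<in>P. \<not> lucky mle U\<^sub>0 U G\<^sub>0 G p})
    < int (\<Prod>{p\<in>P. lucky mle U\<^sub>0 U G\<^sub>0 G p})" (is "_ * ?M < ?N")
proof (cases "m \<in> Poly_Mapping.keys g")
  case True
  thus ?thesis using large g ab unfolding sufficiently_large_def by blast
next
  case False
  hence "a = 0" "b = 1" using ab by (auto simp: in_keys_iff)
  moreover have "g \<noteq> 0" "mcoeff g (lm mle g) = 1"
    using G g by (auto simp: is_reduced_groebner_basis_def)
  hence "quotient_of (mcoeff g (lm mle g)) = (1, 1)" "lm mle g \<in> Poly_Mapping.keys g"
    using lm_in_keys[OF ord] by auto
  hence "(1\<^sup>2 + 1\<^sup>2) * ?M < ?N"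
    using large g unfolding sufficiently_large_def by blast
  moreover have "?M \<ge> 0" by (rule of_nat_0_le_iff)
  ultimately show ?thesis by (simp del: of_nat_prod)
qed

theorem lemma5p6:
  fixes mle :: "'n::finite monom \<Rightarrow> 'n monom \<Rightarrow> bool"
    and I :: "('n, rat) mpoly set"
    and U\<^sub>0 :: "('n, rat) mpoly set \<Rightarrow> ('n, rat) mpoly set"
    and U :: "nat \<Rightarrow> ('n, int) mpoly set \<Rightarrow> ('n, int) mpoly set"
    and G\<^sub>0 :: "('n, rat) mpoly set"
    and G :: "nat \<Rightarrow> ('n, int) mpoly set"
    and P :: "nat set"
  assumes "global_ordering mle"
    and "ideal I W"
    and "ideal (U\<^sub>0 I) W"
    and "\<And>p. prime p \<Longrightarrow> ideal (U p (reduction p I)) (W_mod p)"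
    and "finite {p. prime p \<and> reduction p (U\<^sub>0 I) \<noteq> U p (reduction p I)}"
    and "is_reduced_groebner_basis W mle (U\<^sub>0 I) G\<^sub>0"
    and "\<And>p. prime p \<Longrightarrow> is_reduced_groebner_basis (W_mod p) mle (U p (reduction p I)) (G p)"
    and "finite P"
    and "\<And>p. p \<in> P \<Longrightarrow> prime p"
    and "sufficiently_large mle (U\<^sub>0 I) (\<lambda>p. U p (reduction p I)) G\<^sub>0 G P"
    and "\<And>p. p \<in> P \<Longrightarrow> LM mle G\<^sub>0 = LM mle (G p)"
  shows "(\<forall>F \<in> crt_lift mle P G. \<forall>m. error_tolerant_lift (\<Prod>P) (mcoeff F m) \<noteq> None) \<and>
    lift_poly (\<Prod>P) ` crt_lift mle P G = G\<^sub>0"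
proof -
  note ord = assms(1) and J = assms(3) and G0 = assms(6) and G = assms(7) and fin = assms(8)
    and prime = assms(9) and large = assms(10) and LM = assms(11)
  let ?lucky = "lucky mle (U\<^sub>0 I) (\<lambda>p. U p (reduction p I)) G\<^sub>0 G"
  define L where "L = {p \<in> P. ?lucky p}"
  have PL: "P - L = {p \<in> P. \<not> ?lucky p}" by (auto simp: L_def)
  have LM_G0: "LM mle G\<^sub>0 = lm mle ` G\<^sub>0"
    using G0 by (auto simp: LM_def is_reduced_groebner_basis_def)
  have LM_G: "LM mle (G p) = lm mle ` G p" if "p \<in> P" for p
    using G[OF prime[OF that]] by (auto simp: LM_def is_reduced_groebner_basis_def)
  \<comment> \<open>Congruences come from the lucky primes in \<open>L\<close> alone; at the others
    \<open>F\<close> may have any residue. All \<open>m\<close> are covered, including those outside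
    the support of \<open>g\<close>.\<close>
  have lift: "error_tolerant_lift (\<Prod>P) (mcoeff F m) = Some (mcoeff g m)"
    if g: "g \<in> G\<^sub>0"
      and F: "\<And>p. p \<in> P \<Longrightarrow> mod_coeffs p F \<in> G p \<and> lm mle (mod_coeffs p F) = lm mle g"
    for F g m
  proof -
    obtain a b where ab: "quotient_of (mcoeff g m) = (a, b)" by fastforce
    have b: "b > 0" using ab by (rule quotient_of_denom_pos)
    have "error_tolerant_lift (\<Prod>P) (mcoeff F m) = Some (of_int a / of_int b)"
    proof (rule error_tolerant_lift_lucky[OF fin prime])
      show "L \<subseteq> P" by (auto simp: L_def)
      show "b \<noteq> 0" using b by simp
      show "(a\<^sup>2 + b\<^sup>2) * int (\<Prod>(P - L)) < int (\<Prod>L)"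
        using sufficiently_large_bound[OF ord large G0 g ab] unfolding PL unfolding L_def .
      fix p assume "p \<in> L"
      hence p: "p \<in> P" "prime p" "reduction p (U\<^sub>0 I) = U p (reduction p I)"
        by (auto simp: L_def lucky_def)
      have H: "is_reduced_groebner_basis (W_mod p) mle (reduction p (U\<^sub>0 I)) (G p)"
        using G[OF p(2)] p(3) by simp
      have "[a = mcoeff (mod_coeffs p F) m * b] (mod int p)"
        using F[OF p(1)] ab
        by (intro reduced_groebner_basis_reduction_coeff[OF ord p(2) J G0 H LM[OF p(1)] g]) auto
      thus "[a = mcoeff F m * b] (mod int p)"
        by (simp add: cong_def mod_simps)
    qed
    thus ?thesis using quotient_of_div[OF ab] by simp
  qed
  \<comment> \<open>The common leading monomial of the reductions of \<open>F\<close> belongs to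
    \<open>LM mle G\<^sub>0\<close> by the agreement of leading monomials.\<close>
  have basis_elem: "\<exists>g\<in>G\<^sub>0. \<forall>p\<in>P. mod_coeffs p F \<in> G p \<and> lm mle (mod_coeffs p F) = lm mle g"
    if "F \<in> crt_lift mle P G" for F
    using that LM LM_G0 unfolding crt_lift_def by fastforce
  have lift_poly: "lift_poly (\<Prod>P) F = g"
    if g: "g \<in> G\<^sub>0"
      and F: "\<And>p. p \<in> P \<Longrightarrow> mod_coeffs p F \<in> G p \<and> lm mle (mod_coeffs p F) = lm mle g"
      and "P \<noteq> {}"
    for F g
  proof (rule lift_poly_eqI)
    obtain p where p: "p \<in> P" using \<open>P \<noteq> {}\<close> by blast
    have "p dvd \<Prod>P" using dvd_prodI[OF fin p, of "\<lambda>q. q"] by simp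
    hence "p \<le> \<Prod>P" using prod_primes_pos[OF prime] by (rule dvd_imp_le)
    thus "\<Prod>P > 1" using prime_gt_1_nat[OF prime[OF p]] by linarith
  qed (rule lift[OF g F])
  show ?thesis
  proof (intro conjI ballI allI equalityI subsetI)
    show "error_tolerant_lift (\<Prod>P) (mcoeff F m) \<noteq> None" if "F \<in> crt_lift mle P G" for F m
      using basis_elem[OF that] lift by fastforce
  next
    fix f assume "f \<in> lift_poly (\<Prod>P) ` crt_lift mle P G"
    then obtain F where F: "F \<in> crt_lift mle P G" "f = lift_poly (\<Prod>P) F" by blast
    \<comment> \<open>For empty \<open>P\<close> the union of leading monomials in
      \<open>crt_lift\<close> is empty, so no \<open>F\<close> would exist.\<close>
    have "P \<noteq> {}" using F by (auto simp: crt_lift_def)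
    thus "f \<in> G\<^sub>0" using basis_elem[OF F(1)] lift_poly F(2) by blast
  next
    fix g assume g: "g \<in> G\<^sub>0"
    \<comment> \<open>For empty \<open>P\<close> both products are 1, and the bound would force
      \<open>a\<^sup>2 + b\<^sup>2 < 1\<close> with b > 0.\<close>
    have "P \<noteq> {}"
    proof
      assume "P = {}"
      obtain a b where ab: "quotient_of (mcoeff g 0) = (a, b)" by fastforce
      have "a\<^sup>2 + b\<^sup>2 < 1"
        using sufficiently_large_bound[OF ord large G0 g ab] \<open>P = {}\<close> by simp
      thus False
        using quotient_of_denom_pos[OF ab] by (smt (verit) zero_le_power2 zero_less_power)
    qed
    then obtain p0 where p0: "p0 \<in> P" by blast
    \<comment> \<open>The elements corresponding to \<open>g\<close> are glued to a preimage of
      \<open>g\<close> in the Chinese remainder lift.\<close>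
    have "\<forall>p\<in>P. \<exists>h\<in>G p. lm mle h = lm mle g"
      using g LM LM_G0 LM_G by (metis imageE imageI)
    then obtain H where H: "H p \<in> G p" "lm mle (H p) = lm mle g" if "p \<in> P" for p
      by metis
    have "H p \<in> carrier (W_mod p)" if p: "p \<in> P" for p
    proof -
      interpret ideal "U p (reduction p I)" "W_mod p" by (rule assms(4)[OF prime[OF p]])
      have "H p \<in> U p (reduction p I)"
        using G[OF prime[OF p]] H(1)[OF p]
        by (auto simp: is_reduced_groebner_basis_def is_groebner_basis_def)
      thus ?thesis by (rule a_Hcarr)
    qed
    then obtain F where F: "F \<in> carrier (W_mod (\<Prod>P))" "\<And>p. p \<in> P \<Longrightarrow> mod_coeffs p F = H p"
      using crt_poly[OF fin prime] by blast
    have "lm mle g \<in> (\<Union>p\<in>P. LM mle (G p))"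
      using p0 g LM LM_G0 by auto
    hence "F \<in> crt_lift mle P G"
      using F H unfolding crt_lift_def by auto
    moreover have "lift_poly (\<Prod>P) F = g"
      using F H g \<open>P \<noteq> {}\<close> by (intro lift_poly) auto
    ultimately show "g \<in> lift_poly (\<Prod>P) ` crt_lift mle P G" by blast
  qed
qed

end
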